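(* For a $\mathbb{Z}$-labelled graph $(\hat G,z)$, the following are equivalent: (i) $\mathrm{rd}(\hat G,z)\le1$; (ii) $(\hat G,z)$ has no minor isomorphic to $(K_3,0)$ nor to $(K_2^\bullet,w)$ for any simple labelling $w$; (iii) $(\hat G,z)$ is obtained by a sequence of disjoint unions and $1$-sums of $\mathbb{Z}$-labelled graphs in $\mathcal F$, where $\mathcal F$ consists of all $\mathbb{Z}$-labelled graphs isomorphic either to $(K_2,0)$ or to a $\mathbb{Z}$-labelled graph with a single vertex; (iv) $\hat G$ does not contain a cycle other than selfloops.
   Context: A $\mathbb{Z}$-labelled graph $(\hat G,z)$ is a finite directed multigraph $\hat G=(\hat V,\hat E)$ (selfloops allowed) with a simple labelling $z:\hat E\to\mathbb{Z}$ (selfloops have nonzero labels; no two parallel edges with the same direction and label, nor opposite directions and opposite labels); an edge from $i$ to $j$ with label $\gamma$ is $(i,j;\gamma)$. A cycle is a closed walk $v_1e_1v_2\cdots e_kv_1$ (each $e_t$ an edge with endvertices $v_t,v_{t+1}$, directions ignored) with $v_1,\dots,v_k$ distinct; in particular two parallel edges form a cycle. Minor operations: edge inversion (reverse an edge, negate its label); switching at vertex $i$ by $\gamma$ (each non-loop edge $(i,j;\alpha)$ becomes $(i,j;\alpha+\gamma)$, each non-loop edge $(j,i;\alpha)$ becomes $(j,i;\alpha-\gamma)$). Two $\mathbb{Z}$-labelled graphs are isomorphic if after edge inversions and switchings there is a vertex bijection mapping labelled directed edges exactly onto labelled directed edges. Deletion removes an edge or a vertex (with incident edges), restricting labels. Contraction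 of a non-loop edge $e=(i,j;0)$ identifies $i,j$, removes $e$, and deletes selfloops of label $0$ and redundant parallel edges so the labelling stays simple. A minor is (up to isomorphism) the result of a sequence of deletions and contractions; a subgraph uses only deletions. Union and sums: if $(\hat G_1,z_1)$, $(\hat G_2,z_2)$ are subgraphs of $(\hat G,z)$ (with restricted labels) with $\hat V_1\cup\hat V_2=\hat V$ and $\hat E_1\cup\hat E_2=\hat E$, then $(\hat G,z)$ is their union; it is their disjoint union if $\hat V_1\cap\hat V_2=\emptyset$, and a $1$-sum if $\hat V_1\cap\hat V_2$ is a single vertex. $(K_k,0)$ is the simple complete graph on $k$ vertices (edges oriented arbitrarily) with all labels $0$. $K_2^\bullet$ is the directed multigraph on $\{1,2\}$ with two parallel edges from $1$ to $2$. The lift graph of $(\hat G,z)$ has vertex set $\hat V\times\mathbb{Z}$ (elements $i+\gamma$), edges $\{i+\gamma,j+\gamma+z(e)\}$ for edges $e=(i,j;z(e))$, $\gamma\in\mathbb{Z}$, with $\mathbb{Z}$ acting by translation. For nonzero $\ell\in\mathbb{R}^d$, an $\ell$-periodic framework in $\mathbb{R}^d$ is a map $p$ from the lift graph's vertices to $\mathbb{R}^d$ with $p(v+1)-p(v)=\ell$; periodic frameworks (possibly in different dimensions) are equivalent if all edge lengths agree and their lattice vectors have equal length. $(\hat G,z)$ is $d$-realizable if every periodic framework of its lift graph in any dimension admits an equivalent periodic framework in $\mathbb{R}^d$; $\mathrm{rd}(\hat G,z)$ is the least such nonnegative integer $d$. *)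

theory Defs
  imports
    "HOL-Analysis.Analysis"
    "HOL-Library.Extended_Nat"
    "Graph_Theory.Digraph"
    "Graph_Theory.Digraph_Component"
begin

subsection \<open>Integer-labelled graphs\<close>

type_synonym ('v, 'e) zgraph = "('v, 'e) pre_digraph \<times> ('e \<Rightarrow> int)"

text \<open>
  Two arcs coincide as labelled edges if they agree up to inversion. For selfloops this means that
  the labels \<open>\<gamma>\<close> and \<open>-\<gamma>\<close> are identified, a selfloop being
  its own reversal.
\<close>

definition same_labelled_edge :: "('v, 'e) pre_digraph \<Rightarrow> ('e \<Rightarrow> int) \<Rightarrow> 'e \<Rightarrow> 'e \<Rightarrow> bool" where
  "same_labelled_edge G z e f \<longleftrightarrow>
     (tail G e = tail G f \<and> head G e = head G f \<and> z e = z f) \<or>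
     (tail G e = head G f \<and> head G e = tail G f \<and> z e = - z f)"

definition simple_labelling :: "('v, 'e) pre_digraph \<Rightarrow> ('e \<Rightarrow> int) \<Rightarrow> bool" where
  "simple_labelling G z \<longleftrightarrow>
     (\<forall>e\<in>arcs G. tail G e = head G e \<longrightarrow> z e \<noteq> 0) \<and>
     (\<forall>e\<in>arcs G. \<forall>f\<in>arcs G. e \<noteq> f \<longrightarrow> \<not> same_labelled_edge G z e f)"

definition Z_labelled_graph :: "('v, 'e) pre_digraph \<Rightarrow> ('e \<Rightarrow> int) \<Rightarrow> bool" where
  "Z_labelled_graph G z \<longleftrightarrow> fin_digraph G \<and> simple_labelling G z"

text \<open>
  The list \<open>vs\<close> holds the distinct vertices of the closed walk and \<open>es\<close> its edges, the
  \<open>t\<close>-th edge joining the \<open>t\<close>-th vertex to its cyclic successor in either direction. Distinctness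
  of the edges is only relevant for two vertices, where it prevents a single edge traversed back
  and forth from counting as a cycle.
\<close>

definition undirected_cycle :: "('v, 'e) pre_digraph \<Rightarrow> 'v list \<Rightarrow> 'e list \<Rightarrow> bool" where
  "undirected_cycle G vs es \<longleftrightarrow>
     vs \<noteq> [] \<and> length es = length vs \<and> distinct vs \<and> distinct es \<and>
     set vs \<subseteq> verts G \<and> set es \<subseteq> arcs G \<and>
     (\<forall>t<length vs. {tail G (es ! t), head G (es ! t)} = {vs ! t, vs ! (Suc t mod length vs)})"


subsection \<open>Isomorphism and minors\<close>

definition invert_edge :: "'e \<Rightarrow> ('v, 'e) zgraph \<Rightarrow> ('v, 'e) zgraph" where
  "invert_edge e = (\<lambda>(G, z).
     (G\<lparr>tail := (tail G)(e := head G e), head := (head G)(e := tail G e)\<rparr>, z(e := - z e)))"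

definition switch_vertex :: "'v \<Rightarrow> int \<Rightarrow> ('v, 'e) zgraph \<Rightarrow> ('v, 'e) zgraph" where
  "switch_vertex i \<gamma> = (\<lambda>(G, z).
     (G, \<lambda>e. if tail G e = i \<and> head G e \<noteq> i then z e + \<gamma>
             else if head G e = i \<and> tail G e \<noteq> i then z e - \<gamma>
             else z e))"

inductive relabel_step :: "('v, 'e) zgraph \<Rightarrow> ('v, 'e) zgraph \<Rightarrow> bool" where
  inversion: "e \<in> arcs G \<Longrightarrow> relabel_step (G, z) (invert_edge e (G, z))"
| switching: "i \<in> verts G \<Longrightarrow> relabel_step (G, z) (switch_vertex i \<gamma> (G, z))"

definition zgraph_isomorphic :: "('v, 'e) zgraph \<Rightarrow> ('w, 'f) zgraph \<Rightarrow> bool" where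
  "zgraph_isomorphic X Y \<longleftrightarrow>
     (\<exists>G z. relabel_step\<^sup>*\<^sup>* X (G, z) \<and>
       (case Y of (H, w) \<Rightarrow>
         (\<exists>f g. bij_betw f (verts G) (verts H) \<and> bij_betw g (arcs G) (arcs H) \<and>
           (\<forall>e\<in>arcs G. tail H (g e) = f (tail G e) \<and> head H (g e) = f (head G e) \<and>
              w (g e) = z e))))"

definition identify_ends :: "('v, 'e) pre_digraph \<Rightarrow> 'e \<Rightarrow> ('v, 'e) pre_digraph" where
  "identify_ends G e =
     (let c = (\<lambda>v. if v = head G e then tail G e else v)
      in \<lparr>verts = c ` verts G, arcs = arcs G - {e}, tail = c \<circ> tail G, head = c \<circ> head G\<rparr>)"

text \<open>
  \<open>A\<close> is the set of edges surviving the contraction of \<open>e\<close>: an edge may be dropped only if it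
  becomes a selfloop labelled \<open>0\<close> or coincides, as a labelled edge, with a surviving one.
\<close>

definition contraction_arcs ::
    "('v, 'e) pre_digraph \<Rightarrow> ('e \<Rightarrow> int) \<Rightarrow> 'e \<Rightarrow> 'e set \<Rightarrow> bool" where
  "contraction_arcs G z e A \<longleftrightarrow>
     (let H = identify_ends G e
      in A \<subseteq> arcs H \<and> simple_labelling (H\<lparr>arcs := A\<rparr>) z \<and>
         (\<forall>f\<in>arcs H - A. (tail H f = head H f \<and> z f = 0) \<or>
            (\<exists>g\<in>A. same_labelled_edge H z f g)))"

inductive minor_step :: "('v, 'e) zgraph \<Rightarrow> ('v, 'e) zgraph \<Rightarrow> bool" where
  relabel: "relabel_step X Y \<Longrightarrow> minor_step X Y"
| delete_edge: "e \<in> arcs G \<Longrightarrow> minor_step (G, z) (pre_digraph.del_arc G e, z)"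
| delete_vertex: "v \<in> verts G \<Longrightarrow> minor_step (G, z) (pre_digraph.del_vert G v, z)"
| contract: "\<lbrakk>e \<in> arcs G; tail G e \<noteq> head G e; z e = 0; contraction_arcs G z e A\<rbrakk>
     \<Longrightarrow> minor_step (G, z) ((identify_ends G e)\<lparr>arcs := A\<rparr>, z)"

text \<open>
  Inversions and switchings may be interleaved with deletions and contractions, since contraction
  requires an edge labelled \<open>0\<close>. Renaming vertices and edges commutes with all operations and
  is therefore needed only once, at the end.
\<close>

definition has_minor_isomorphic :: "('v, 'e) zgraph \<Rightarrow> ('w, 'f) zgraph \<Rightarrow> bool" where
  "has_minor_isomorphic X Y \<longleftrightarrow> (\<exists>X'. minor_step\<^sup>*\<^sup>* X X' \<and> zgraph_isomorphic X' Y)"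


subsection \<open>Special graphs, disjoint unions and 1-sums\<close>

definition complete_graph :: "nat \<Rightarrow> (nat, nat \<times> nat) pre_digraph" where
  "complete_graph k = \<lparr>verts = {1..k}, arcs = {(i, j). 1 \<le> i \<and> i < j \<and> j \<le> k}, tail = fst, head = snd\<rparr>"

definition K2_bullet :: "(nat, bool) pre_digraph" where
  "K2_bullet = \<lparr>verts = {1, 2}, arcs = UNIV, tail = (\<lambda>_. 1), head = (\<lambda>_. 2)\<rparr>"

definition is_union :: "('v, 'e) pre_digraph \<Rightarrow> ('v, 'e) pre_digraph \<Rightarrow> ('v, 'e) pre_digraph \<Rightarrow> bool" where
  "is_union G G1 G2 \<longleftrightarrow> subgraph G1 G \<and> subgraph G2 G \<and>
     verts G1 \<union> verts G2 = verts G \<and> arcs G1 \<union> arcs G2 = arcs G"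

definition is_disjoint_union :: "('v, 'e) pre_digraph \<Rightarrow> ('v, 'e) pre_digraph \<Rightarrow> ('v, 'e) pre_digraph \<Rightarrow> bool" where
  "is_disjoint_union G G1 G2 \<longleftrightarrow> is_union G G1 G2 \<and> verts G1 \<inter> verts G2 = {}"

definition is_one_sum :: "('v, 'e) pre_digraph \<Rightarrow> ('v, 'e) pre_digraph \<Rightarrow> ('v, 'e) pre_digraph \<Rightarrow> bool" where
  "is_one_sum G G1 G2 \<longleftrightarrow> is_union G G1 G2 \<and> (\<exists>v. verts G1 \<inter> verts G2 = {v})"

definition in_F :: "('v, 'e) pre_digraph \<Rightarrow> ('e \<Rightarrow> int) \<Rightarrow> bool" where
  "in_F G z \<longleftrightarrow> Z_labelled_graph G z \<and>
     (zgraph_isomorphic (G, z) (complete_graph 2, \<lambda>_. 0) \<or>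
      (\<exists>(H :: ('v, 'e) pre_digraph) w. Z_labelled_graph H w \<and> (\<exists>v. verts H = {v}) \<and>
         zgraph_isomorphic (G, z) (H, w)))"

text \<open>
  Graphs built from members of the family by disjoint unions and 1-sums. The null graph is included
  as the disjoint union of no graphs; on graphs with at least one vertex the first rule has no
  effect. Labels of summands are restrictions of \<open>z\<close>.
\<close>

inductive sum_of_F :: "('v, 'e) pre_digraph \<Rightarrow> ('e \<Rightarrow> int) \<Rightarrow> bool" where
  null: "Z_labelled_graph G z \<Longrightarrow> verts G = {} \<Longrightarrow> sum_of_F G z"
| base: "in_F G z \<Longrightarrow> sum_of_F G z"
| disjoint_union: "\<lbrakk>Z_labelled_graph G z; is_disjoint_union G G1 G2; sum_of_F G1 z; sum_of_F G2 z\<rbrakk>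
     \<Longrightarrow> sum_of_F G z"
| one_sum: "\<lbrakk>Z_labelled_graph G z; is_one_sum G G1 G2; sum_of_F G1 z; sum_of_F G2 z\<rbrakk>
     \<Longrightarrow> sum_of_F G z"


subsection \<open>Periodic frameworks and the realizable dimension\<close>

definition lift_verts :: "('v, 'e) pre_digraph \<Rightarrow> ('v \<times> int) set" where
  "lift_verts G = verts G \<times> UNIV"

definition lift_edges :: "('v, 'e) pre_digraph \<Rightarrow> ('e \<Rightarrow> int) \<Rightarrow> ('v \<times> int) set set" where
  "lift_edges G z = {{(tail G e, \<gamma>), (head G e, \<gamma> + z e)} |e \<gamma>. e \<in> arcs G}"

text \<open>
  The dimension varies inside the definitions below, so vectors of \<open>d\<close>-dimensional Euclidean
  space are functions on \<^typ>\<open>nat\<close> vanishing from index \<open>d\<close> on.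
\<close>

abbreviation R_space :: "nat \<Rightarrow> (nat \<Rightarrow> real) set" where
  "R_space d \<equiv> topspace (Euclidean_space d)"

abbreviation vec_length :: "nat \<Rightarrow> (nat \<Rightarrow> real) \<Rightarrow> real" where
  "vec_length d x \<equiv> L2_set x {..<d}"

definition periodic_framework ::
    "('v, 'e) pre_digraph \<Rightarrow> nat \<Rightarrow> (nat \<Rightarrow> real) \<Rightarrow> ('v \<times> int \<Rightarrow> nat \<Rightarrow> real) \<Rightarrow> bool" where
  "periodic_framework G d l p \<longleftrightarrow>
     l \<in> R_space d \<and> l \<noteq> (\<lambda>_. 0) \<and>
     (\<forall>x\<in>lift_verts G. p x \<in> R_space d) \<and>
     (\<forall>i \<gamma>. (i, \<gamma>) \<in> lift_verts G \<longrightarrow> p (i, \<gamma> + 1) - p (i, \<gamma>) = l)"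

definition equivalent_frameworks ::
    "('v, 'e) pre_digraph \<Rightarrow> ('e \<Rightarrow> int) \<Rightarrow>
     nat \<Rightarrow> (nat \<Rightarrow> real) \<Rightarrow> ('v \<times> int \<Rightarrow> nat \<Rightarrow> real) \<Rightarrow>
     nat \<Rightarrow> (nat \<Rightarrow> real) \<Rightarrow> ('v \<times> int \<Rightarrow> nat \<Rightarrow> real) \<Rightarrow> bool" where
  "equivalent_frameworks G z d l p d' l' p' \<longleftrightarrow>
     (\<forall>x y. {x, y} \<in> lift_edges G z \<longrightarrow>
        vec_length d (p x - p y) = vec_length d' (p' x - p' y)) \<and>
     vec_length d l = vec_length d' l'"

definition realizable :: "nat \<Rightarrow> ('v, 'e) pre_digraph \<Rightarrow> ('e \<Rightarrow> int) \<Rightarrow> bool" where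
  "realizable d G z \<longleftrightarrow>
     (\<forall>d' l' p'. periodic_framework G d' l' p' \<longrightarrow>
        (\<exists>l p. periodic_framework G d l p \<and> equivalent_frameworks G z d' l' p' d l p))"

definition rd :: "('v, 'e) pre_digraph \<Rightarrow> ('e \<Rightarrow> int) \<Rightarrow> enat" where
  "rd G z = (INF d\<in>{d. realizable d G z}. enat d)"

end

theory Submission
  imports Defs
begin

text \<open>
  The implications run (i), (ii), (iv), (iii), (i). One-dimensional realizability passes to minors,
  because a framework of a contraction is one of the original graph with an edge of length 0, and
  neither an equilateral triangle nor two equally long parallel edges attached off the lattice line
  fit on a line. A cycle becomes a forbidden minor by deleting everything else and repeatedly
  switching an edge to label 0 and contracting it; the sum of the labels around the cycle decides
  between the triangle and the parallel edges. In a graph without nontrivial cycles every non-loop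
  edge is a bridge, so the graph is a 1-sum of that edge with smaller graphs of the same kind, and
  line placements can be glued along 1-sums by translation.
\<close>

subsection \<open>Realizability on a line\<close>

text \<open>Two obstructions arise because a cycle, traversed in one direction, has a sum of labels
  that no switching changes and that contracting an edge labelled 0 preserves. If the sum is 0, the
  cycle lifts to closed cycles; otherwise its lift runs off along the lattice. Contraction can
  therefore be carried down to two edges only if the sum is nonzero. With sum 0 the last two edges
  would coincide as labelled edges and one of them would be dropped, so the reduction has to stop at
  the triangle.

  On the metric side, a line placement may be translated without affecting any edge length or the
  lattice vector. This freedom is exactly what is used up in matching two placements at one common
  vertex.\<close>

text \<open>By periodicity a framework is given by its points at level 0; reflecting the line, the
  one-dimensional lattice vector may be taken positive. Only the coordinates below the dimension
  enter, so membership in the coordinate space need not be required.\<close>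
definition line_realizable :: "('v, 'e) pre_digraph \<Rightarrow> ('e \<Rightarrow> int) \<Rightarrow> bool" where
  "line_realizable G z \<longleftrightarrow>
     (\<forall>d l q. vec_length d l \<noteq> 0 \<longrightarrow>
        (\<exists>r :: 'v \<Rightarrow> real. \<forall>e\<in>arcs G.
           \<bar>r (head G e) - r (tail G e) + z e * vec_length d l\<bar> =
           vec_length d (\<lambda>k. q (head G e) k - q (tail G e) k + z e * l k)))"

lemma vec_length_uminus: "vec_length d (\<lambda>k. - x k) = vec_length d x"
  by (simp add: L2_set_def)

lemma vec_length_minus_commute: "vec_length d (x - y) = vec_length d (y - x)"
  by (simp add: L2_set_def power2_commute)

lemma vec_length_1: "vec_length (Suc 0) x = \<bar>x 0\<bar>"
  by (simp add: L2_set_def)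

lemma vec_length_cmult: "vec_length d (\<lambda>k. c * x k) = \<bar>c\<bar> * vec_length d x"
proof -
  have "(\<Sum>i<d. (c * x i)\<^sup>2) = c\<^sup>2 * (\<Sum>i<d. (x i)\<^sup>2)"
    by (simp add: power_mult_distrib sum_distrib_left)
  then show ?thesis
    by (simp add: L2_set_def real_sqrt_mult)
qed

text \<open>Turns the condition \<open>l \<noteq> (\<lambda>_. 0)\<close> on a lattice vector into a
  nonzero length, which is the hypothesis inside \<open>line_realizable\<close>.\<close>

lemma vec_length_eq_0_R_space:
  assumes "x \<in> R_space d" "vec_length d x = 0"
  shows "x = (\<lambda>_. 0)"
proof
  fix i
  show "x i = 0"
    using assms by (cases "i < d") (auto simp: L2_set_eq_0_iff topspace_Euclidean_space)
qed

text \<open>Recovers the whole framework from level 0 and the lattice vector. The induction runs in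
  both directions because levels may be negative.\<close>

lemma periodic_framework_shift:
  assumes "periodic_framework G d l p" "i \<in> verts G"
  shows "p (i, \<gamma>) k = p (i, 0) k + of_int \<gamma> * l k"
proof -
  have step: "p (i, \<gamma> + 1) k = p (i, \<gamma>) k + l k" for \<gamma>
  proof -
    have "p (i, \<gamma> + 1) - p (i, \<gamma>) = l"
      using assms by (auto simp: periodic_framework_def lift_verts_def)
    then show ?thesis
      by (auto simp: fun_eq_iff algebra_simps dest: spec[of _ k])
  qed
  show ?thesis
  proof (induction \<gamma> rule: int_induct[where k = 0])
    case (step1 \<gamma>)
    then show ?case by (simp add: step distrib_right)
  next
    case (step2 \<gamma>)
    then show ?case using step[of "\<gamma> - 1"] by (simp add: left_diff_distrib)
  qed simp
qed

lemma realizable_1_imp_line_realizable: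
  assumes "wf_digraph G" "realizable 1 G z"
  shows "line_realizable G z"
  unfolding line_realizable_def
proof (intro allI impI)
  fix d :: nat and l :: "nat \<Rightarrow> real" and q :: "'a \<Rightarrow> nat \<Rightarrow> real"
  assume l: "vec_length d l \<noteq> 0"
  \<comment> \<open>Coordinates from \<open>d\<close> on are cut off: \<open>l\<close> and
    \<open>q\<close> are arbitrary there, while a framework has to lie in
    \<open>R_space d\<close>.\<close>
  define l' where "l' = (\<lambda>k. if k < d then l k else 0)"
  define p' where "p' = (\<lambda>(i, \<gamma>::int) k. if k < d then q i k + of_int \<gamma> * l k else 0)"
  have len_l': "vec_length d l' = vec_length d l"
    by (auto simp: l'_def L2_set_def)
  have "l' \<noteq> (\<lambda>_. 0)"
    using l len_l' by (auto simp: L2_set_def)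
  then have "periodic_framework G d l' p'"
    by (auto simp: periodic_framework_def topspace_Euclidean_space l'_def p'_def algebra_simps)
  then obtain l2 p where fw: "periodic_framework G 1 l2 p"
    and eq: "equivalent_frameworks G z d l' p' 1 l2 p"
    using assms unfolding realizable_def by blast
  define L where "L = l2 0"
  have L: "\<bar>L\<bar> = vec_length d l"
    using eq by (simp add: equivalent_frameworks_def len_l' L_def vec_length_1)
  have "\<bar>sgn L * p (head G e, 0) 0 - sgn L * p (tail G e, 0) 0 + z e * vec_length d l\<bar> =
      vec_length d (\<lambda>k. q (head G e) k - q (tail G e) k + z e * l k)" if e: "e \<in> arcs G" for e
  proof -
    have h: "head G e \<in> verts G"
      using assms(1) e by (simp add: wf_digraph.head_in_verts)
    have "{(head G e, z e), (tail G e, 0)} \<in> lift_edges G z"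
      using e by (force simp: lift_edges_def)
    then have "vec_length d (p' (head G e, z e) - p' (tail G e, 0)) =
        \<bar>p (head G e, z e) 0 - p (tail G e, 0) 0\<bar>"
      using eq by (simp add: equivalent_frameworks_def vec_length_1)
    also have "\<dots> = \<bar>p (head G e, 0) 0 - p (tail G e, 0) 0 + z e * L\<bar>"
      using periodic_framework_shift[OF fw h, of "z e" 0] by (simp add: L_def algebra_simps)
    also have "\<dots> = \<bar>sgn L * p (head G e, 0) 0 - sgn L * p (tail G e, 0) 0 + z e * vec_length d l\<bar>"
      using l unfolding L[symmetric] by (cases "L > 0") auto
    finally show ?thesis
      by (simp add: p'_def L2_set_def algebra_simps)
  qed
  then show "\<exists>r. \<forall>e\<in>arcs G. \<bar>r (head G e) - r (tail G e) + z e * vec_length d l\<bar> =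
      vec_length d (\<lambda>k. q (head G e) k - q (tail G e) k + z e * l k)"
    by (intro exI[of _ "\<lambda>i. sgn L * p (i, 0) 0"]) blast
qed

lemma line_realizable_imp_realizable_1:
  assumes "wf_digraph G" "line_realizable G z"
  shows "realizable 1 G z"
  unfolding realizable_def
proof (intro allI impI)
  fix d l p'
  assume fw: "periodic_framework G d l p'"
  then have l: "vec_length d l \<noteq> 0"
    using vec_length_eq_0_R_space[of l d] by (auto simp: periodic_framework_def)
  obtain r :: "'a \<Rightarrow> real" where r: "\<And>e. e \<in> arcs G \<Longrightarrow>
      \<bar>r (head G e) - r (tail G e) + z e * vec_length d l\<bar> =
      vec_length d (\<lambda>k. p' (head G e, 0) k - p' (tail G e, 0) k + z e * l k)"
    using assms(2)[unfolded line_realizable_def, rule_format, OF l, of "\<lambda>i. p' (i, 0)"] by blast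
  define L where "L = (\<lambda>k::nat. if k = 0 then vec_length d l else 0)"
  define p where "p = (\<lambda>(i, \<gamma>::int) k::nat. if k = 0 then r i + of_int \<gamma> * vec_length d l else 0)"
  have "periodic_framework G 1 L p"
    using l by (auto simp: periodic_framework_def topspace_Euclidean_space L_def p_def
        fun_eq_iff algebra_simps)
  moreover have "equivalent_frameworks G z d l p' 1 L p"
    unfolding equivalent_frameworks_def
  proof (intro conjI allI impI)
    show "vec_length d l = vec_length 1 L"
      by (simp add: vec_length_1 L_def)
    fix x y
    assume "{x, y} \<in> lift_edges G z"
    then obtain e \<gamma> where e: "e \<in> arcs G" and
      xy: "{x, y} = {(tail G e, \<gamma>), (head G e, \<gamma> + z e)}"
      by (auto simp: lift_edges_def)
    have ends: "tail G e \<in> verts G" "head G e \<in> verts G"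
      using assms(1) e by (auto simp: wf_digraph.head_in_verts wf_digraph.tail_in_verts)
    have "p' (head G e, \<gamma> + z e) - p' (tail G e, \<gamma>) =
        (\<lambda>k. p' (head G e, 0) k - p' (tail G e, 0) k + z e * l k)"
      using periodic_framework_shift[OF fw ends(1), of \<gamma>]
        periodic_framework_shift[OF fw ends(2), of "\<gamma> + z e"]
      by (simp add: fun_eq_iff algebra_simps)
    then have "vec_length d (p' (head G e, \<gamma> + z e) - p' (tail G e, \<gamma>)) =
        vec_length 1 (p (head G e, \<gamma> + z e) - p (tail G e, \<gamma>))"
      using r[OF e] by (simp add: vec_length_1 p_def algebra_simps)
    then show "vec_length d (p' x - p' y) = vec_length 1 (p x - p y)"
      using xy by (metis doubleton_eq_iff vec_length_minus_commute)
  qed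
  ultimately show "\<exists>l' p. periodic_framework G 1 l' p \<and> equivalent_frameworks G z d l p' 1 l' p"
    by blast
qed

text \<open>The only vector of dimension 0 is zero, which is forbidden as a lattice vector, whereas
  frameworks in dimension 1 always exist: every vertex can be placed at its level. This holds even
  for the null graph.\<close>

lemma not_realizable_0: "\<not> realizable 0 G z"
proof
  assume "realizable 0 G z"
  moreover have "periodic_framework G 1 (\<lambda>k. if k = 0 then 1 else 0)
      (\<lambda>(i, \<gamma>) k. if k = 0 then of_int \<gamma> else 0)"
    by (auto simp: periodic_framework_def topspace_Euclidean_space fun_eq_iff)
  ultimately obtain l p where "periodic_framework G 0 l p"
    unfolding realizable_def by blast
  then show False
    by (auto simp: periodic_framework_def topspace_Euclidean_space)
qed

text \<open>Dimension 0 being excluded, failure in dimension 1 would leave only dimensions from 2 on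
  in the set, and its infimum would be at least 2, or infinite if the set is empty.\<close>

lemma rd_le_1_iff_line_realizable:
  assumes "wf_digraph G"
  shows "rd G z \<le> 1 \<longleftrightarrow> line_realizable G z"
proof -
  have "rd G z \<le> 1 \<longleftrightarrow> realizable 1 G z"
  proof
    assume "realizable 1 G z"
    then show "rd G z \<le> 1"
      unfolding rd_def one_enat_def by (auto intro: INF_lower)
  next
    assume le: "rd G z \<le> 1"
    show "realizable 1 G z"
    proof (rule ccontr)
      assume "\<not> realizable 1 G z"
      then have "2 \<le> d" if "realizable d G z" for d
        using that not_realizable_0[of G z]
        by (cases "d = 0 \<or> d = 1") auto
      then have "enat 2 \<le> rd G z"
        unfolding rd_def by (intro INF_greatest) auto
      from order.trans[OF this le] have "enat 2 \<le> enat 1"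
        by (simp only: one_enat_def)
      then show False by simp
    qed
  qed
  then show ?thesis
    using assms realizable_1_imp_line_realizable line_realizable_imp_realizable_1 by blast
qed

subsection \<open>Minor monotonicity\<close>

text \<open>An inversion only changes the sign of the vector along the edge. A switching at
  \<open>i\<close> shifts the levels of the copies of \<open>i\<close>; moving the point of
  \<open>i\<close> by the corresponding multiple of the lattice vector compensates for this, in the
  given framework and on the line alike.\<close>

lemma line_realizable_relabel_step:
  assumes "relabel_step X Y" "wf_digraph (fst X)" "line_realizable (fst X) (snd X)"
  shows "wf_digraph (fst Y) \<and> line_realizable (fst Y) (snd Y)"
  using assms
proof (induction rule: relabel_step.induct)
  case (inversion e G z)
  then have wf: "wf_digraph G" and lr: "line_realizable G z" by auto
  have "line_realizable (fst (invert_edge e (G, z))) (snd (invert_edge e (G, z)))"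
    unfolding line_realizable_def
  proof (intro allI impI)
    fix d l and q :: "_ \<Rightarrow> nat \<Rightarrow> real"
    assume l: "vec_length d l \<noteq> 0"
    obtain r :: "_ \<Rightarrow> real" where r: "\<And>e. e \<in> arcs G \<Longrightarrow>
      \<bar>r (head G e) - r (tail G e) + z e * vec_length d l\<bar> =
      vec_length d (\<lambda>k. q (head G e) k - q (tail G e) k + z e * l k)"
      using lr[unfolded line_realizable_def, rule_format, OF l, of q] by blast
    have "\<bar>r (tail G e) - r (head G e) - z e * vec_length d l\<bar> =
      vec_length d (\<lambda>k. q (tail G e) k - q (head G e) k - z e * l k)"
      using r[OF inversion(1)]
        vec_length_uminus[where d = d and x = "\<lambda>k. q (head G e) k - q (tail G e) k + z e * l k"]
      by (simp add: algebra_simps)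
    then show "\<exists>r. \<forall>f\<in>arcs (fst (invert_edge e (G, z))).
        \<bar>r (head (fst (invert_edge e (G, z))) f) - r (tail (fst (invert_edge e (G, z))) f)
           + real_of_int (snd (invert_edge e (G, z)) f) * vec_length d l\<bar> =
        vec_length d (\<lambda>k. q (head (fst (invert_edge e (G, z))) f) k
           - q (tail (fst (invert_edge e (G, z))) f) k
           + real_of_int (snd (invert_edge e (G, z)) f) * l k)"
      by (intro exI[of _ r]) (auto simp: invert_edge_def r)
  qed
  moreover have "wf_digraph (fst (invert_edge e (G, z)))"
    using wf by (auto simp: invert_edge_def wf_digraph_def)
  ultimately show ?case by blast
next
  case (switching i G z \<gamma>)
  then have wf: "wf_digraph G" and lr: "line_realizable G z" by auto
  have "line_realizable G (snd (switch_vertex i \<gamma> (G, z)))"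
    unfolding line_realizable_def
  proof (intro allI impI)
    fix d l and q :: "_ \<Rightarrow> nat \<Rightarrow> real"
    assume l: "vec_length d l \<noteq> 0"
    define s where "s v = (if v = i then real_of_int \<gamma> else 0)" for v
    obtain r :: "_ \<Rightarrow> real" where r: "\<And>e. e \<in> arcs G \<Longrightarrow>
      \<bar>r (head G e) - r (tail G e) + z e * vec_length d l\<bar> =
      vec_length d (\<lambda>k. (q (head G e) k - s (head G e) * l k)
         - (q (tail G e) k - s (tail G e) * l k) + z e * l k)"
      using lr[unfolded line_realizable_def, rule_format, OF l, of "\<lambda>v k. q v k - s v * l k"]
      by blast
    \<comment> \<open>Written as a difference of a function at the two ends, the change of label
      covers all cases at once; at a loop the two terms cancel.\<close>
    have lab: "real_of_int (snd (switch_vertex i \<gamma> (G, z)) e) =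
        z e + s (tail G e) - s (head G e)" for e
      by (auto simp: switch_vertex_def s_def)
    show "\<exists>r. \<forall>e\<in>arcs G. \<bar>r (head G e) - r (tail G e)
           + real_of_int (snd (switch_vertex i \<gamma> (G, z)) e) * vec_length d l\<bar> =
        vec_length d (\<lambda>k. q (head G e) k - q (tail G e) k
           + real_of_int (snd (switch_vertex i \<gamma> (G, z)) e) * l k)"
      unfolding lab
      by (intro exI[of _ "\<lambda>v. r v + s v * vec_length d l"] ballI)
        (use r in \<open>simp add: algebra_simps\<close>)
  qed
  then show ?case
    using wf by (simp add: switch_vertex_def)
qed

lemma line_realizable_subset:
  assumes "line_realizable G z" "arcs H \<subseteq> arcs G" "tail H = tail G" "head H = head G"
  shows "line_realizable H z"
  unfolding line_realizable_def
proof (intro allI impI)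
  fix d l and q :: "_ \<Rightarrow> nat \<Rightarrow> real"
  assume "vec_length d l \<noteq> 0"
  from assms(1)[unfolded line_realizable_def, rule_format, OF this, of q]
  show "\<exists>r. \<forall>e\<in>arcs H. \<bar>r (head H e) - r (tail H e) + z e * vec_length d l\<bar> =
      vec_length d (\<lambda>k. q (head H e) k - q (tail H e) k + z e * l k)"
    using assms(2-4) by auto
qed

lemma line_realizable_minor_step:
  assumes "minor_step X Y" "wf_digraph (fst X)" "line_realizable (fst X) (snd X)"
  shows "wf_digraph (fst Y) \<and> line_realizable (fst Y) (snd Y)"
  using assms
proof (induction rule: minor_step.induct)
  case (relabel X Y)
  then show ?case using line_realizable_relabel_step by blast
next
  case (delete_edge e G z)
  then show ?case
    by (auto simp: wf_digraph_def pre_digraph.del_arc_def elim!: line_realizable_subset)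
next
  case (delete_vertex v G z)
  then show ?case
    by (auto simp: wf_digraph_def pre_digraph.del_vert_def elim!: line_realizable_subset)
next
  case (contract e G z A)
  define c where "c v = (if v = head G e then tail G e else v)" for v
  have H: "identify_ends G e =
      \<lparr>verts = c ` verts G, arcs = arcs G - {e}, tail = c \<circ> tail G, head = c \<circ> head G\<rparr>"
    by (simp add: identify_ends_def Let_def c_def[abs_def])
  have A: "A \<subseteq> arcs G"
    using contract(4) by (auto simp: contraction_arcs_def Let_def H)
  have "line_realizable ((identify_ends G e)\<lparr>arcs := A\<rparr>) z"
    unfolding line_realizable_def
  proof (intro allI impI)
    fix d l and q :: "_ \<Rightarrow> nat \<Rightarrow> real"
    assume l: "vec_length d l \<noteq> 0"
    obtain r :: "_ \<Rightarrow> real" where r: "\<And>e. e \<in> arcs G \<Longrightarrow>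
      \<bar>r (head G e) - r (tail G e) + z e * vec_length d l\<bar> =
      vec_length d (\<lambda>k. q (c (head G e)) k - q (c (tail G e)) k + z e * l k)"
      using contract(6)[unfolded line_realizable_def fst_conv snd_conv, rule_format, OF l,
          of "q \<circ> c"] by auto
    have "c (head G e) = c (tail G e)"
      by (simp add: c_def)
    \<comment> \<open>Pulling \<open>q\<close> back along \<open>c\<close> gives \<open>e\<close>
      length 0, and its label is 0, so the line placement must bring its ends together as well.
      Hence \<open>r\<close> is constant on the fibres of \<open>c\<close> and serves the
      contraction unchanged.\<close>
    then have "r (head G e) = r (tail G e)"
      using r[OF contract(1)] contract(3) by (simp add: L2_set_def)
    then have rc: "r (c v) = r v" for v
      by (simp add: c_def)
    show "\<exists>r. \<forall>f\<in>arcs (identify_ends G e\<lparr>arcs := A\<rparr>).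
        \<bar>r (head (identify_ends G e\<lparr>arcs := A\<rparr>) f) - r (tail (identify_ends G e\<lparr>arcs := A\<rparr>) f)
           + z f * vec_length d l\<bar> =
        vec_length d (\<lambda>k. q (head (identify_ends G e\<lparr>arcs := A\<rparr>) f) k
           - q (tail (identify_ends G e\<lparr>arcs := A\<rparr>) f) k + z f * l k)"
      using r A by (intro exI[of _ r]) (auto simp: H rc)
  qed
  moreover have "wf_digraph ((identify_ends G e)\<lparr>arcs := A\<rparr>)"
    using contract(5) A by (auto simp: wf_digraph_def H)
  ultimately show ?case by simp
qed

lemma line_realizable_isomorphic:
  assumes "zgraph_isomorphic X (H, w)" "wf_digraph (fst X)" "line_realizable (fst X) (snd X)"
    "wf_digraph H"
  shows "line_realizable H w"
proof -
  obtain G z f g where steps: "relabel_step\<^sup>*\<^sup>* X (G, z)"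
    and f: "bij_betw f (verts G) (verts H)" and g: "bij_betw g (arcs G) (arcs H)"
    and fg: "\<And>e. e \<in> arcs G \<Longrightarrow>
      tail H (g e) = f (tail G e) \<and> head H (g e) = f (head G e) \<and> w (g e) = z e"
    using assms(1) unfolding zgraph_isomorphic_def by auto
  have "wf_digraph (fst (G, z)) \<and> line_realizable (fst (G, z)) (snd (G, z))"
    using steps
    by (induction rule: rtranclp_induct) (use assms line_realizable_relabel_step in blast)+
  then have wf: "wf_digraph G" and lr: "line_realizable G z" by auto
  define h where "h = the_inv_into (verts G) f"
  have h: "h (f v) = v" if "v \<in> verts G" for v
    using f that by (simp add: h_def bij_betw_def the_inv_into_f_f)
  show ?thesis
    unfolding line_realizable_def
  proof (intro allI impI)
    fix d l and q :: "_ \<Rightarrow> nat \<Rightarrow> real"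
    assume l: "vec_length d l \<noteq> 0"
    obtain r :: "_ \<Rightarrow> real" where r: "\<And>e. e \<in> arcs G \<Longrightarrow>
      \<bar>r (head G e) - r (tail G e) + z e * vec_length d l\<bar> =
      vec_length d (\<lambda>k. q (f (head G e)) k - q (f (tail G e)) k + z e * l k)"
      using lr[unfolded line_realizable_def, rule_format, OF l, of "q \<circ> f"] by auto
    have "\<bar>r (h (head H e')) - r (h (tail H e')) + w e' * vec_length d l\<bar> =
      vec_length d (\<lambda>k. q (head H e') k - q (tail H e') k + w e' * l k)"
      if e': "e' \<in> arcs H" for e'
    proof -
      obtain e where e: "e \<in> arcs G" "e' = g e"
        using g e' by (auto simp: bij_betw_def)
      then show ?thesis
        using r fg wf by (simp add: h wf_digraph_def)
    qed
    then show "\<exists>r. \<forall>e\<in>arcs H. \<bar>r (head H e) - r (tail H e) + w e * vec_length d l\<bar> =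
        vec_length d (\<lambda>k. q (head H e) k - q (tail H e) k + w e * l k)"
      by (intro exI[of _ "r \<circ> h"]) simp
  qed
qed

lemma line_realizable_minor:
  assumes "has_minor_isomorphic (G, z) (H, w)" "wf_digraph G" "line_realizable G z" "wf_digraph H"
  shows "line_realizable H w"
proof -
  obtain X where steps: "minor_step\<^sup>*\<^sup>* (G, z) X" and iso: "zgraph_isomorphic X (H, w)"
    using assms(1) unfolding has_minor_isomorphic_def by blast
  have "wf_digraph (fst X) \<and> line_realizable (fst X) (snd X)"
    using steps
    by (induction rule: rtranclp_induct) (use assms line_realizable_minor_step in force)+
  then show ?thesis
    using line_realizable_isomorphic iso assms(4) by blast
qed

section \<open>The two forbidden minors on a line\<close>

lemma not_line_realizable_K3: "\<not> line_realizable (complete_graph 3) (\<lambda>_. 0)"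
proof
  assume lr: "line_realizable (complete_graph 3) (\<lambda>_. 0)"
  \<comment> \<open>The unit vectors with indices 1, 2, 3 form an equilateral triangle of side
    \<open>sqrt 2\<close>. The dimension is 4 because vertex numbers serve directly as coordinate
    indices and index 0 is left out. All labels being 0, any lattice vector of nonzero length will
    do.\<close>
  define q :: "nat \<Rightarrow> nat \<Rightarrow> real" where "q i k = of_bool (i = k)" for i k
  have "vec_length 4 (\<lambda>_. 1) \<noteq> 0"
    by (simp add: L2_set_def)
  then obtain r :: "nat \<Rightarrow> real" where r: "\<And>e. e \<in> arcs (complete_graph 3) \<Longrightarrow>
      \<bar>r (head (complete_graph 3) e) - r (tail (complete_graph 3) e)\<bar> =
      vec_length 4 (\<lambda>k. q (head (complete_graph 3) e) k - q (tail (complete_graph 3) e) k)"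
    using lr[unfolded line_realizable_def, rule_format, where d = 4 and l = "\<lambda>_. 1" and q = q] by auto
  have "\<bar>r 2 - r 1\<bar> = sqrt 2" "\<bar>r 3 - r 1\<bar> = sqrt 2" "\<bar>r 3 - r 2\<bar> = sqrt 2"
    using r[of "(1, 2)"] r[of "(1, 3)"] r[of "(2, 3)"]
    by (simp_all add: complete_graph_def q_def L2_set_def eval_nat_numeral)
  moreover have "sqrt 2 > 0" by simp
  ultimately show False by linarith
qed

text \<open>On a line, equal lengths of the two edges force the second vertex to be the midpoint
  between the two translates; leaving the line at that midpoint gives an unattainable length.\<close>
lemma not_line_realizable_K2_bullet:
  assumes "simple_labelling K2_bullet w"
  shows "\<not> line_realizable K2_bullet w"
proof
  assume lr: "line_realizable K2_bullet w"
  define a b where "a = real_of_int (w True)" and "b = real_of_int (w False)"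
  have "True \<in> arcs K2_bullet" "False \<in> arcs K2_bullet"
    by (simp_all add: K2_bullet_def)
  then have "\<not> same_labelled_edge K2_bullet w True False"
    using assms unfolding simple_labelling_def by blast
  then have "w True \<noteq> w False"
    by (simp add: same_labelled_edge_def K2_bullet_def)
  then have ab: "a \<noteq> b" by (simp add: a_def b_def)
  define l :: "nat \<Rightarrow> real" where "l k = of_bool (k = 0)" for k
  define q :: "nat \<Rightarrow> nat \<Rightarrow> real"
    where "q i k = (if i = 1 then 0 else if k = 0 then - (a + b) / 2 else 1)" for i k
  have l: "vec_length 2 l = 1"
    by (simp add: L2_set_def l_def eval_nat_numeral)
  then obtain r :: "nat \<Rightarrow> real" where r: "\<And>e.
      \<bar>r 2 - r 1 + w e\<bar> = vec_length 2 (\<lambda>k. q 2 k - q 1 k + w e * l k)"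
    using lr[unfolded line_realizable_def, rule_format, where d = 2 and l = l and q = q]
    by (auto simp: K2_bullet_def)
  define x where "x = r 2 - r 1"
  have sum2: "(\<Sum>k<2. h k) = h 0 + h 1" for h :: "nat \<Rightarrow> real"
    by (simp add: numeral_2_eq_2)
  have "\<bar>x + w e\<bar>\<^sup>2 = (w e - (a + b) / 2)\<^sup>2 + 1" for e
    unfolding x_def r
    by (simp add: L2_set_def sum2 q_def l_def field_simps)
  from this[of True] this[of False]
  have eqs: "(x + a)\<^sup>2 = ((a - b) / 2)\<^sup>2 + 1" "(x + b)\<^sup>2 = ((a - b) / 2)\<^sup>2 + 1"
    by (simp_all add: a_def[symmetric] b_def[symmetric] field_simps power2_eq_square)
  then have "(a - b) * (2 * x + a + b) = 0"
    by (simp add: algebra_simps power2_eq_square)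
  with ab have "x = - (a + b) / 2" by simp
  with eqs(1) show False
    by (simp add: field_simps power2_eq_square)
qed

subsection \<open>Disjoint unions and 1-sums\<close>

text \<open>The length of a loop is fixed by its label and the length of the lattice vector,
  whatever the placement.\<close>

lemma line_realizable_loops:
  fixes G :: "('v, 'e) pre_digraph" and z :: "'e \<Rightarrow> int"
  assumes "\<And>e. e \<in> arcs G \<Longrightarrow> tail G e = head G e"
  shows "line_realizable G z"
  unfolding line_realizable_def
proof (intro allI impI)
  fix d :: nat and l :: "nat \<Rightarrow> real" and q :: "'v \<Rightarrow> nat \<Rightarrow> real"
  show "\<exists>r. \<forall>e\<in>arcs G. \<bar>r (head G e) - r (tail G e) + z e * vec_length d l\<bar> =
      vec_length d (\<lambda>k. q (head G e) k - q (tail G e) k + z e * l k)"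
    using assms by (intro exI[of _ "\<lambda>_. 0"]) (simp add: vec_length_cmult abs_mult L2_set_nonneg)
qed

lemma line_realizable_single_arc:
  fixes G :: "('v, 'e) pre_digraph" and z :: "'e \<Rightarrow> int"
  assumes "arcs G = {e}"
  shows "line_realizable G z"
proof (cases "tail G e = head G e")
  case True
  then show ?thesis
    using assms by (intro line_realizable_loops) auto
next
  case False
  show ?thesis
    unfolding line_realizable_def
  proof (intro allI impI)
    fix d :: nat and l :: "nat \<Rightarrow> real" and q :: "'v \<Rightarrow> nat \<Rightarrow> real"
    define x where "x = vec_length d (\<lambda>k. q (head G e) k - q (tail G e) k + z e * l k)"
    have "x \<ge> 0" by (simp add: x_def L2_set_nonneg)
    then show "\<exists>r. \<forall>e\<in>arcs G. \<bar>r (head G e) - r (tail G e) + z e * vec_length d l\<bar> =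
        vec_length d (\<lambda>k. q (head G e) k - q (tail G e) k + z e * l k)"
      using assms False
      \<comment> \<open>The tail sits at 0, and the head is displaced so that adding the shift of
        the label gives exactly the required length \<open>x\<close>, which is nonnegative.\<close>
      by (intro exI[of _ "\<lambda>v. if v = head G e then x - z e * vec_length d l else 0"])
        (simp add: x_def)
  qed
qed

text \<open>A translation of the second line placement makes it agree with the first one at the only
  possible common vertex.\<close>
lemma line_realizable_union:
  assumes un: "is_union G G1 G2" and int: "verts G1 \<inter> verts G2 \<subseteq> {v}"
    and lr: "line_realizable G1 z" "line_realizable G2 z"
  shows "line_realizable G z"
  unfolding line_realizable_def
proof (intro allI impI)
  fix d l and q :: "_ \<Rightarrow> nat \<Rightarrow> real"
  assume l: "vec_length d l \<noteq> 0"
  have G1: "wf_digraph G1" "tail G1 = tail G" "head G1 = head G"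
    and G2: "wf_digraph G2" "tail G2 = tail G" "head G2 = head G"
    and arcs: "arcs G = arcs G1 \<union> arcs G2"
    using un by (auto simp: is_union_def subgraph_def compatible_def)
  obtain r1 where r1: "\<And>e. e \<in> arcs G1 \<Longrightarrow>
      \<bar>r1 (head G e) - r1 (tail G e) + z e * vec_length d l\<bar> =
      vec_length d (\<lambda>k. q (head G e) k - q (tail G e) k + z e * l k)"
    using lr(1)[unfolded line_realizable_def, rule_format, OF l, of q] G1 by auto
  obtain r2 where r2: "\<And>e. e \<in> arcs G2 \<Longrightarrow>
      \<bar>r2 (head G e) - r2 (tail G e) + z e * vec_length d l\<bar> =
      vec_length d (\<lambda>k. q (head G e) k - q (tail G e) k + z e * l k)"
    using lr(2)[unfolded line_realizable_def, rule_format, OF l, of q] G2 by auto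
  define r where "r x = (if x \<in> verts G1 then r1 x else r2 x + (r1 v - r2 v))" for x
  have r_1: "r x = r1 x" if "x \<in> verts G1" for x
    using that by (simp add: r_def)
  have r_2: "r x = r2 x + (r1 v - r2 v)" if "x \<in> verts G2" for x
    using that int by (auto simp: r_def)
  have "\<bar>r (head G e) - r (tail G e) + z e * vec_length d l\<bar> =
      vec_length d (\<lambda>k. q (head G e) k - q (tail G e) k + z e * l k)" if "e \<in> arcs G" for e
    using that unfolding arcs
  proof
    assume e: "e \<in> arcs G1"
    then have "tail G e \<in> verts G1" "head G e \<in> verts G1"
      using G1 by (auto simp: wf_digraph_def)
    then show ?thesis using r1[OF e] by (simp add: r_1)
  next
    assume e: "e \<in> arcs G2"
    then have "tail G e \<in> verts G2" "head G e \<in> verts G2"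
      using G2 by (auto simp: wf_digraph_def)
    then show ?thesis using r2[OF e] by (simp add: r_2)
  qed
  then show "\<exists>r. \<forall>e\<in>arcs G. \<bar>r (head G e) - r (tail G e) + z e * vec_length d l\<bar> =
      vec_length d (\<lambda>k. q (head G e) k - q (tail G e) k + z e * l k)"
    by blast
qed

section \<open>Members of the family on a line\<close>

lemma relabel_steps_verts_arcs:
  assumes "relabel_step\<^sup>*\<^sup>* X Y"
  shows "verts (fst Y) = verts (fst X) \<and> arcs (fst Y) = arcs (fst X)"
  using assms
proof (induction rule: rtranclp_induct)
  case (step Y Z)
  from step.hyps(2) have "verts (fst Z) = verts (fst Y) \<and> arcs (fst Z) = arcs (fst Y)"
    by cases (auto simp: invert_edge_def switch_vertex_def)
  with step.IH show ?case by simp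
qed simp

lemma zgraph_isomorphic_bij_betw:
  assumes "zgraph_isomorphic (G, z) (H, w)"
  shows "\<exists>f. bij_betw f (verts G) (verts H)" "\<exists>g. bij_betw g (arcs G) (arcs H)"
  using assms relabel_steps_verts_arcs unfolding zgraph_isomorphic_def by fastforce+

text \<open>Counting suffices: an isomorphism preserves the numbers of vertices and arcs, and both a
  graph with one arc and a graph with one vertex can be placed on a line for all labels.\<close>

lemma in_F_imp_line_realizable:
  assumes "in_F G z"
  shows "line_realizable G z"
proof -
  have wf: "wf_digraph G"
    using assms by (auto simp: in_F_def Z_labelled_graph_def fin_digraph_def)
  consider "zgraph_isomorphic (G, z) (complete_graph 2, \<lambda>_. 0)"
    | H :: "('a, 'b) pre_digraph" and w v where "verts H = {v}" "zgraph_isomorphic (G, z) (H, w)"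
    using assms unfolding in_F_def by blast
  then show ?thesis
  proof cases
    case 1
    then obtain g where "bij_betw g (arcs G) (arcs (complete_graph 2))"
      using zgraph_isomorphic_bij_betw(2) by blast
    moreover have "arcs (complete_graph 2) = {(1, 2)}"
      by (auto simp: complete_graph_def)
    ultimately have "card (arcs G) = 1"
      by (simp add: bij_betw_same_card)
    then show ?thesis
      using line_realizable_single_arc by (metis card_1_singletonE)
  next
    case 2
    then have "card (verts G) = 1"
      using zgraph_isomorphic_bij_betw(1)[OF 2(2)] by (auto dest: bij_betw_same_card)
    then obtain u where "verts G = {u}"
      by (rule card_1_singletonE)
    then show ?thesis
      using wf by (intro line_realizable_loops) (auto simp: wf_digraph_def)
  qed
qed

lemma sum_of_F_imp_line_realizable:
  assumes "sum_of_F G z"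
  shows "line_realizable G z"
  using assms
proof (induction rule: sum_of_F.induct)
  case (null G z)
  then have "arcs G = {}"
    by (auto simp: Z_labelled_graph_def fin_digraph_def wf_digraph_def)
  then show ?case by (intro line_realizable_loops) simp
next
  case (base G z)
  then show ?case by (rule in_F_imp_line_realizable)
next
  case (disjoint_union G z G1 G2)
  then show ?case
    unfolding is_disjoint_union_def by (blast intro: line_realizable_union)
next
  case (one_sum G z G1 G2)
  then show ?case
    unfolding is_one_sum_def by (blast intro: line_realizable_union)
qed

subsection \<open>Decomposition of acyclic graphs\<close>

text \<open>A cycle through one vertex consists of one edge with both ends there, a loop; being
  nontrivial is thus a matter of length, which is easier to handle in constructions.\<close>

lemma nontrivial_cycle_iff_length:
  "(\<exists>vs es. undirected_cycle G vs es \<and> \<not> (\<exists>e. es = [e] \<and> tail G e = head G e)) \<longleftrightarrow>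
   (\<exists>vs es. undirected_cycle G vs es \<and> 2 \<le> length vs)"
proof -
  have "\<not> (\<exists>e. es = [e] \<and> tail G e = head G e) \<longleftrightarrow> 2 \<le> length vs"
    if c: "undirected_cycle G vs es" for vs es
  proof (cases "2 \<le> length vs")
    case True
    then show ?thesis using c by (auto simp: undirected_cycle_def)
  next
    case False
    then obtain v e where "vs = [v]" "es = [e]"
      using c by (cases vs; cases es) (auto simp: undirected_cycle_def Suc_le_eq)
    then show ?thesis
      using c by (auto simp: undirected_cycle_def)
  qed
  then show ?thesis by blast
qed

lemma Z_labelled_graph_subgraph:
  assumes "Z_labelled_graph G z" "wf_digraph H" "verts H \<subseteq> verts G" "arcs H \<subseteq> arcs G"
    "tail H = tail G" "head H = head G"
  shows "Z_labelled_graph H z"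
proof -
  have "finite (verts G)" "finite (arcs G)"
    using assms(1) by (auto simp: Z_labelled_graph_def fin_digraph_def fin_digraph_axioms_def)
  then have "finite (verts H)" "finite (arcs H)"
    using assms by (auto intro: finite_subset)
  then have "fin_digraph H"
    using assms(2) by (simp add: fin_digraph_def fin_digraph_axioms_def)
  moreover have "same_labelled_edge H z = same_labelled_edge G z"
    by (simp add: fun_eq_iff same_labelled_edge_def assms(5,6))
  then have "simple_labelling H z"
    using assms(1,4) by (auto simp: Z_labelled_graph_def simple_labelling_def assms(5,6))
  ultimately show ?thesis by (simp add: Z_labelled_graph_def)
qed

lemma is_unionI:
  assumes "wf_digraph G" "wf_digraph G1" "wf_digraph G2"
    "tail G1 = tail G" "head G1 = head G" "tail G2 = tail G" "head G2 = head G"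
    "verts G1 \<union> verts G2 = verts G" "arcs G1 \<union> arcs G2 = arcs G"
  shows "is_union G G1 G2"
  using assms by (auto simp: is_union_def subgraph_def compatible_def)

lemma undirected_cycle_mono:
  assumes "undirected_cycle H vs es" "verts H \<subseteq> verts G" "arcs H \<subseteq> arcs G"
    "tail H = tail G" "head H = head G"
  shows "undirected_cycle G vs es"
  using assms by (auto simp: undirected_cycle_def)

section \<open>Undirected paths and the cycles that they close\<close>

definition link :: "('v, 'e) pre_digraph \<Rightarrow> 'e set \<Rightarrow> ('v \<times> 'v) set" where
  "link G A = {(x, y). \<exists>e\<in>A. {tail G e, head G e} = {x, y}}"

text \<open>A walk is built up edge by edge; whenever it returns to a vertex already visited, it is
  cut back to its first visit there, which keeps the vertices distinct. Reachability of all vertices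
  is recorded because \<open>link\<close> does not refer to \<open>verts G\<close>; membership in
  the graph is derived from it later.\<close>

lemma link_path:
  assumes "(u, v) \<in> (link G A)\<^sup>*"
  shows "\<exists>vs es. length vs = Suc (length es) \<and> vs ! 0 = u \<and> last vs = v \<and> distinct vs \<and>
     set es \<subseteq> A \<and> set vs \<subseteq> (link G A)\<^sup>* `` {u} \<and>
     (\<forall>t<length es. {tail G (es ! t), head G (es ! t)} = {vs ! t, vs ! Suc t})"
  using assms
proof (induction rule: rtrancl_induct)
  case base
  show ?case by (intro exI[of _ "[u]"] exI[of _ "[]"]) auto
next
  case (step v w)
  then obtain vs es where IH: "length vs = Suc (length es)" "vs ! 0 = u" "last vs = v" "distinct vs"
     "set es \<subseteq> A" "set vs \<subseteq> (link G A)\<^sup>* `` {u}"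
     "\<forall>t<length es. {tail G (es ! t), head G (es ! t)} = {vs ! t, vs ! Suc t}" by blast
  obtain e where e: "e \<in> A" "{tail G e, head G e} = {v, w}"
    using step.hyps(2) by (auto simp: link_def)
  show ?case
  proof (cases "w \<in> set vs")
    case True
    then obtain n where n: "n < length vs" "vs ! n = w" by (auto simp: in_set_conv_nth)
    have "last (take (Suc n) vs) = w"
      using n by (simp add: take_Suc_conv_app_nth)
    then show ?thesis
      using IH n set_take_subset[of n es] set_take_subset[of "Suc n" vs]
      by (intro exI[of _ "take (Suc n) vs"] exI[of _ "take n es"]) (auto simp: min_def)
  next
    case False
    have v: "vs ! length es = v"
      using IH by (metis last_conv_nth length_0_conv nat.distinct(1) diff_Suc_1)
    have "(u, w) \<in> (link G A)\<^sup>*"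
      using step.hyps by (rule rtrancl_into_rtrancl)
    moreover have "{tail G ((es @ [e]) ! t), head G ((es @ [e]) ! t)}
        = {(vs @ [w]) ! t, (vs @ [w]) ! Suc t}" if "t < length (es @ [e])" for t
      using that IH(1,7) e v by (cases "t < length es") (auto simp: nth_append less_Suc_eq)
    ultimately show ?thesis
      using IH e False
      by (intro exI[of _ "vs @ [w]"] exI[of _ "es @ [e]"]) (auto simp: nth_append)
  qed
qed

text \<open>A non-loop edge that is not a bridge lies on a cycle: \<open>e\<close> closes a path
  that joins its ends and avoids it. A parallel edge yields a path of length 1 and hence a cycle on
  two vertices.\<close>

lemma undirected_cycle_close_path:
  assumes wf: "wf_digraph G" and e: "e \<in> arcs G" "tail G e \<noteq> head G e"
    and path: "(tail G e, head G e) \<in> (link G (arcs G - {e}))\<^sup>*"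
  shows "\<exists>vs es. undirected_cycle G vs es \<and> 2 \<le> length vs"
proof -
  define A where "A = arcs G - {e}"
  obtain vs es where p: "length vs = Suc (length es)" "vs ! 0 = tail G e" "last vs = head G e"
     "distinct vs" "set es \<subseteq> A" "set vs \<subseteq> (link G A)\<^sup>* `` {tail G e}"
     "\<forall>t<length es. {tail G (es ! t), head G (es ! t)} = {vs ! t, vs ! Suc t}"
    using link_path[OF path] unfolding A_def by blast
  have closed: "y \<in> verts G" if "(tail G e, y) \<in> (link G A)\<^sup>*" for y
    using that
  proof (cases rule: rtranclE)
    case base
    then show ?thesis using wf e by (auto simp: wf_digraph_def)
  next
    case (step x)
    then show ?thesis
      using wf by (auto simp: link_def A_def wf_digraph_def doubleton_eq_iff)
  qed
  have last: "vs ! length es = head G e"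
    using p by (metis last_conv_nth length_0_conv nat.distinct(1) diff_Suc_1)
  have "length es \<noteq> 0"
    using e(2) last p(2) by auto
  have "distinct es"
    unfolding distinct_conv_nth
  proof (intro allI impI)
    fix s t assume st: "s < length es" "t < length es" "s \<noteq> t"
    \<comment> \<open>Different steps of a path with distinct vertices have different pairs of ends,
      so no edge is repeated.\<close>
    have "{vs ! s, vs ! Suc s} \<noteq> {vs ! t, vs ! Suc t}"
      using st p(1,4) by (auto simp: doubleton_eq_iff nth_eq_iff_index_eq)
    then show "es ! s \<noteq> es ! t"
      using p(7) st by metis
  qed
  moreover have "{tail G ((es @ [e]) ! t), head G ((es @ [e]) ! t)}
      = {vs ! t, vs ! (Suc t mod length vs)}" if "t < length vs" for t
  proof (cases "t < length es")
    case True
    then have "Suc t mod length vs = Suc t" using p(1) by simp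
    then show ?thesis using True p(7) by (simp add: nth_append)
  next
    case False
    \<comment> \<open>At the last index the successor wraps around to 0, and the edge there is
      \<open>e\<close>, leading from the last vertex back to the first.\<close>
    then have "t = length es" using that p(1) by simp
    then show ?thesis using p(1,2) last by auto
  qed
  ultimately have "undirected_cycle G vs (es @ [e])"
    unfolding undirected_cycle_def
    using p(1,4,5,6) closed e by (auto simp: A_def)
  moreover have "2 \<le> length vs"
    using \<open>length es \<noteq> 0\<close> p(1) by linarith
  ultimately show ?thesis by blast
qed

section \<open>Splitting an acyclic graph at a bridge\<close>

lemma zgraph_isomorphic_refl: "zgraph_isomorphic (G, z) (G, z)"
  unfolding zgraph_isomorphic_def
  by (auto intro!: exI[of _ G] exI[of _ z] exI[of _ id] simp: bij_betw_def)

lemma in_F_single_vertex: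
  assumes "Z_labelled_graph G z" "verts G = {v}"
  shows "in_F G z"
  using assms zgraph_isomorphic_refl unfolding in_F_def by blast

text \<open>Switching at the tail brings the label of a lone edge to 0, so any label is admissible
  for membership in the family.\<close>

lemma in_F_single_edge:
  assumes Z: "Z_labelled_graph G z" and G: "arcs G = {e}" "verts G = {tail G e, head G e}"
    "tail G e \<noteq> head G e"
  shows "in_F G z"
proof -
  define z' where "z' = snd (switch_vertex (tail G e) (- z e) (G, z))"
  have "relabel_step (G, z) (switch_vertex (tail G e) (- z e) (G, z))"
    using G by (intro relabel_step.switching) auto
  then have step: "relabel_step\<^sup>*\<^sup>* (G, z) (G, z')"
    by (simp add: z'_def switch_vertex_def)
  have "z' e = 0"
    using G(3) by (simp add: z'_def switch_vertex_def)
  moreover have "arcs (complete_graph 2) = {(1, 2)}" "verts (complete_graph 2) = {1, 2}"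
    by (auto simp: complete_graph_def)
  ultimately have "zgraph_isomorphic (G, z) (complete_graph 2, \<lambda>_. 0)"
    unfolding zgraph_isomorphic_def
    using step G
    by (auto simp: bij_betw_def complete_graph_def intro!: exI[of _ G] exI[of _ z']
        exI[of _ "\<lambda>v. if v = tail G e then 1 else 2"] exI[of _ "\<lambda>_. (1, 2)"])
  then show ?thesis
    using Z by (simp add: in_F_def)
qed

lemma acyclic_imp_sum_of_F:
  assumes "Z_labelled_graph G z" "\<not> (\<exists>vs es. undirected_cycle G vs es \<and> 2 \<le> length vs)"
  shows "sum_of_F G z"
  using assms
proof (induction "card (verts G)" arbitrary: G rule: less_induct)
  case (less G)
  note Z = less.prems(1)
  have fin: "finite (verts G)" and wf: "wf_digraph G"
    using Z by (auto simp: Z_labelled_graph_def fin_digraph_def fin_digraph_axioms_def)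
  have ends: "tail G e \<in> verts G" "head G e \<in> verts G" if "e \<in> arcs G" for e
    using wf that by (auto simp: wf_digraph_def)
  define ind where "ind S = G\<lparr>verts := S, arcs := {e \<in> arcs G. tail G e \<in> S \<and> head G e \<in> S}\<rparr>" for S
  have wf_ind: "wf_digraph (ind S)" for S
    by (auto simp: ind_def wf_digraph_def)
  have Z_ind: "Z_labelled_graph (ind S) z" if "S \<subseteq> verts G" for S
    by (rule Z_labelled_graph_subgraph[OF Z wf_ind]) (use that in \<open>auto simp: ind_def\<close>)
  have IH: "sum_of_F (ind S) z" if "S \<subset> verts G" for S
  proof (rule less.hyps)
    show "card (verts (ind S)) < card (verts G)"
      using that fin by (simp add: ind_def psubset_card_mono)
    show "Z_labelled_graph (ind S) z"
      using that Z_ind by blast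
    show "\<not> (\<exists>vs es. undirected_cycle (ind S) vs es \<and> 2 \<le> length vs)"
      using less.prems(2) undirected_cycle_mono[of "ind S" _ _ G] that by (auto simp: ind_def)
  qed
  show ?case
  proof (cases "\<forall>e\<in>arcs G. tail G e = head G e")
    case loops: True
    show ?thesis
    proof (cases "verts G = {}")
      case True
      then show ?thesis using Z by (rule sum_of_F.null[rotated])
    next
      case False
      then obtain v where v: "v \<in> verts G" by blast
      show ?thesis
      proof (cases "verts G = {v}")
        case True
        then show ?thesis using Z by (intro sum_of_F.base in_F_single_vertex)
      next
        case False
        \<comment> \<open>All arcs are loops here, so none joins \<open>v\<close> to the other
          vertices.\<close>
        have "is_disjoint_union G (ind {v}) (ind (verts G - {v}))"
          unfolding is_disjoint_union_def
          by (intro conjI is_unionI wf wf_ind) (use v loops ends in \<open>auto simp: ind_def\<close>)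
        moreover have "{v} \<subset> verts G" "verts G - {v} \<subset> verts G"
          using False v by blast+
        ultimately show ?thesis
          using sum_of_F.disjoint_union[OF Z] IH by blast
      qed
    qed
  next
    case False
    then obtain e where e: "e \<in> arcs G" "tail G e \<noteq> head G e" by blast
    \<comment> \<open>The component of the tail after removal of \<open>e\<close>. Since
      \<open>e\<close> is a bridge, \<open>C\<close> misses its head and the complement misses its
      tail; both are proper subsets, to which the induction hypothesis applies.\<close>
    define C where "C = {w. (tail G e, w) \<in> (link G (arcs G - {e}))\<^sup>*}"
    have hC: "head G e \<notin> C"
      using undirected_cycle_close_path[OF wf e] less.prems(2) by (auto simp: C_def)
    have tC: "tail G e \<in> C" by (simp add: C_def)
    have CV: "C \<subseteq> verts G"
    proof
      fix y assume "y \<in> C"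
      then have "(tail G e, y) \<in> (link G (arcs G - {e}))\<^sup>*" by (simp add: C_def)
      then show "y \<in> verts G"
        by (cases rule: rtranclE) (use ends e in \<open>auto simp: link_def doubleton_eq_iff\<close>)
    qed
    have closed: "tail G f \<in> C \<longleftrightarrow> head G f \<in> C" if "f \<in> arcs G" "f \<noteq> e" for f
    proof -
      have "(tail G f, head G f) \<in> link G (arcs G - {e})" "(head G f, tail G f) \<in> link G (arcs G - {e})"
        using that by (auto simp: link_def)
      then show ?thesis
        unfolding C_def mem_Collect_eq by (meson rtrancl.rtrancl_into_rtrancl)
    qed
    \<comment> \<open>The graph is glued from three pieces by two 1-sums: \<open>ind C\<close> meets
      the bridge \<open>K\<close> in the tail of \<open>e\<close>, giving \<open>H\<close>, and
      \<open>H\<close> meets the rest in the head of \<open>e\<close>.\<close>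
    define K where "K = G\<lparr>verts := {tail G e, head G e}, arcs := {e}\<rparr>"
    define H where "H = G\<lparr>verts := insert (head G e) C, arcs := insert e (arcs (ind C))\<rparr>"
    have wfK: "wf_digraph K" and wfH: "wf_digraph H"
      using tC by (auto simp: K_def H_def ind_def wf_digraph_def)
    have ZK: "Z_labelled_graph K z"
      by (rule Z_labelled_graph_subgraph[OF Z wfK]) (use e ends in \<open>auto simp: K_def\<close>)
    have ZH: "Z_labelled_graph H z"
      by (rule Z_labelled_graph_subgraph[OF Z wfH]) (use e ends CV in \<open>auto simp: H_def ind_def\<close>)
    have "sum_of_F K z"
      by (intro sum_of_F.base in_F_single_edge[OF ZK, of e]) (use e in \<open>auto simp: K_def\<close>)
    moreover have "is_one_sum H (ind C) K"
      unfolding is_one_sum_def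
      by (intro conjI is_unionI wfK wfH wf_ind exI[of _ "tail G e"])
        (use tC hC in \<open>auto simp: H_def K_def ind_def\<close>)
    moreover have "sum_of_F (ind C) z"
      by (rule IH) (use CV hC e ends in auto)
    ultimately have "sum_of_F H z"
      using sum_of_F.one_sum[OF ZH] by blast
    moreover have "sum_of_F (ind (verts G - C)) z"
      by (rule IH) (use CV tC in auto)
    moreover have "is_one_sum G H (ind (verts G - C))"
      unfolding is_one_sum_def
    proof (intro conjI is_unionI wf wfH wf_ind exI[of _ "head G e"])
      show "arcs H \<union> arcs (ind (verts G - C)) = arcs G"
        using closed e ends by (auto simp: H_def ind_def)
    qed (use hC e ends CV in \<open>auto simp: H_def ind_def\<close>)
    ultimately show ?thesis
      using sum_of_F.one_sum[OF Z] by blast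
  qed
qed

subsection \<open>Cycles contain forbidden minors\<close>

text \<open>All arcs point the same way around, so the list of arcs alone determines the cyclic list
  of vertices, and contracting the first arc just removes it from the list.\<close>

definition spanning_cycle :: "('v, 'e) pre_digraph \<Rightarrow> 'e list \<Rightarrow> bool" where
  "spanning_cycle G es \<longleftrightarrow>
     distinct (map (tail G) es) \<and> map (head G) es = rotate1 (map (tail G) es) \<and>
     arcs G = set es \<and> verts G = set (map (tail G) es)"

lemma minor_delete_arcs:
  assumes "finite B" "B \<subseteq> arcs G"
  shows "minor_step\<^sup>*\<^sup>* (G, z) (G\<lparr>arcs := arcs G - B\<rparr>, z)"
  using assms
proof (induction B rule: finite_induct)
  case (insert e B)
  have "minor_step (G\<lparr>arcs := arcs G - B\<rparr>, z) (pre_digraph.del_arc (G\<lparr>arcs := arcs G - B\<rparr>) e, z)"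
    using insert by (intro minor_step.delete_edge) auto
  moreover have "pre_digraph.del_arc (G\<lparr>arcs := arcs G - B\<rparr>) e = G\<lparr>arcs := arcs G - insert e B\<rparr>"
    by (auto simp: pre_digraph.del_arc_def intro!: pre_digraph.equality)
  ultimately show ?case
    using insert by (auto intro: rtranclp.rtrancl_into_rtrancl)
qed simp

lemma minor_delete_isolated_verts:
  assumes "finite B" "B \<subseteq> verts G" "\<And>e. e \<in> arcs G \<Longrightarrow> tail G e \<notin> B \<and> head G e \<notin> B"
  shows "minor_step\<^sup>*\<^sup>* (G, z) (G\<lparr>verts := verts G - B\<rparr>, z)"
  using assms
proof (induction B rule: finite_induct)
  case (insert v B)
  have "minor_step (G\<lparr>verts := verts G - B\<rparr>, z) (pre_digraph.del_vert (G\<lparr>verts := verts G - B\<rparr>) v, z)"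
    using insert by (intro minor_step.delete_vertex) auto
  moreover have "pre_digraph.del_vert (G\<lparr>verts := verts G - B\<rparr>) v = G\<lparr>verts := verts G - insert v B\<rparr>"
    using insert.prems(2) by (auto simp: pre_digraph.del_vert_def intro!: pre_digraph.equality)
  ultimately show ?case
    using insert by (auto intro: rtranclp.rtrancl_into_rtrancl)
qed simp

lemma minor_invert_arcs:
  assumes "finite B" "B \<subseteq> arcs G"
  shows "minor_step\<^sup>*\<^sup>* (G, z)
    (G\<lparr>tail := \<lambda>e. if e \<in> B then head G e else tail G e,
       head := \<lambda>e. if e \<in> B then tail G e else head G e\<rparr>, \<lambda>e. if e \<in> B then - z e else z e)"
  using assms
proof (induction B rule: finite_induct)
  case (insert f B)
  let ?H = "G\<lparr>tail := \<lambda>e. if e \<in> B then head G e else tail G e,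
       head := \<lambda>e. if e \<in> B then tail G e else head G e\<rparr>"
  let ?w = "\<lambda>e. if e \<in> B then - z e else z e"
  have "minor_step (?H, ?w) (invert_edge f (?H, ?w))"
    using insert by (intro minor_step.relabel relabel_step.inversion) auto
  moreover have "invert_edge f (?H, ?w) =
    (G\<lparr>tail := \<lambda>e. if e \<in> insert f B then head G e else tail G e,
       head := \<lambda>e. if e \<in> insert f B then tail G e else head G e\<rparr>,
     \<lambda>e. if e \<in> insert f B then - z e else z e)"
    using insert(2) by (auto simp: invert_edge_def intro!: pre_digraph.equality)
  ultimately show ?case
    using insert by (auto intro: rtranclp.rtrancl_into_rtrancl)
qed simp

lemma has_minor_isomorphic_trans:
  assumes "minor_step\<^sup>*\<^sup>* X X'" "has_minor_isomorphic X' Y"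
  shows "has_minor_isomorphic X Y"
  using assms unfolding has_minor_isomorphic_def by (blast intro: rtranclp_trans)

section \<open>Forbidden minors at the end of the reduction\<close>

definition has_forbidden_minor :: "('v, 'e) zgraph \<Rightarrow> bool" where
  "has_forbidden_minor X \<longleftrightarrow> has_minor_isomorphic X (complete_graph 3, \<lambda>_. 0) \<or>
     (\<exists>w. simple_labelling K2_bullet w \<and> has_minor_isomorphic X (K2_bullet, w))"

lemma has_forbidden_minor_trans:
  "minor_step\<^sup>*\<^sup>* X X' \<Longrightarrow> has_forbidden_minor X' \<Longrightarrow> has_forbidden_minor X"
  unfolding has_forbidden_minor_def by (auto dest: has_minor_isomorphic_trans)

text \<open>The two arcs run in opposite directions; inverting \<open>f\<close> makes them parallel
  with labels \<open>z e\<close> and \<open>- z f\<close>. These differ because the sum around the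
  cycle is nonzero, so the labelling is simple.\<close>

lemma has_forbidden_minor_2_cycle:
  assumes cyc: "spanning_cycle G [e, f]" and lab: "z e + z f \<noteq> 0"
  shows "has_forbidden_minor (G, z)"
proof -
  have G: "arcs G = {e, f}" "verts G = {tail G e, tail G f}" "head G e = tail G f"
    "head G f = tail G e" "tail G e \<noteq> tail G f" "e \<noteq> f"
    using cyc by (auto simp: spanning_cycle_def)
  obtain H z' where H: "invert_edge f (G, z) = (H, z')" by (cases "invert_edge f (G, z)")
  have H': "arcs H = {e, f}" "verts H = {tail G e, tail G f}" "tail H e = tail G e"
    "head H e = tail G f" "tail H f = tail G e" "head H f = tail G f" "z' e = z e" "z' f = - z f"
    using H G by (auto simp: invert_edge_def)
  define w where "w b = (if b then z e else - z f)" for b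
  have "relabel_step (G, z) (H, z')"
    using G(1) unfolding H[symmetric] by (intro relabel_step.inversion) simp
  then have "zgraph_isomorphic (G, z) (K2_bullet, w)"
    unfolding zgraph_isomorphic_def
    using G(5,6) H'
    by (auto simp: bij_betw_def K2_bullet_def w_def inj_on_def UNIV_bool
        intro!: exI[of _ H] exI[of _ z'] r_into_rtranclp
        exI[of _ "\<lambda>v. if v = tail G e then 1 else 2"] exI[of _ "\<lambda>x. x = e"])
  moreover have "simple_labelling K2_bullet w"
    using lab by (auto simp: simple_labelling_def same_labelled_edge_def K2_bullet_def w_def)
  ultimately show ?thesis
    unfolding has_forbidden_minor_def has_minor_isomorphic_def by blast
qed

lemma has_forbidden_minor_balanced_3_cycle:
  assumes cyc: "spanning_cycle G [e, f, g]" and lab: "z e = 0" "z f + z g = 0"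
  shows "has_forbidden_minor (G, z)"
proof -
  define a b c where abc: "a = tail G e" "b = tail G f" "c = tail G g"
  have G: "arcs G = {e, f, g}" "verts G = {a, b, c}" "tail G e = a" "tail G f = b" "tail G g = c"
    "head G e = b" "head G f = c" "head G g = a"
    "a \<noteq> b" "a \<noteq> c" "b \<noteq> c" "e \<noteq> f" "e \<noteq> g" "f \<noteq> g"
    using cyc by (auto simp: spanning_cycle_def abc)
  \<comment> \<open>The arc \<open>f\<close> enters \<open>c\<close> and \<open>g\<close> leaves it,
    so this switching subtracts \<open>z f\<close> from the label of \<open>f\<close> and adds it to
    that of \<open>g\<close>; both become 0. Inverting \<open>g\<close> afterwards matches the
    orientation in \<open>complete_graph 3\<close>.\<close>
  define z' where "z' = snd (switch_vertex c (z f) (G, z))"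
  have z': "switch_vertex c (z f) (G, z) = (G, z')"
    by (simp add: z'_def switch_vertex_def)
  have z'0: "z' e = 0" "z' f = 0" "z' g = 0"
    using lab G by (simp_all add: z'_def switch_vertex_def)
  obtain H w where H: "invert_edge g (G, z') = (H, w)" by (cases "invert_edge g (G, z')")
  have H': "arcs H = {e, f, g}" "verts H = {a, b, c}" "tail H e = a" "tail H f = b" "tail H g = a"
    "head H e = b" "head H f = c" "head H g = c" "w e = 0" "w f = 0" "w g = 0"
    using H G z'0 by (auto simp: invert_edge_def)
  have "relabel_step (G, z) (G, z')"
    using G(2) unfolding z'[symmetric] by (intro relabel_step.switching) simp
  moreover have "relabel_step (G, z') (H, w)"
    using G(1) unfolding H[symmetric] by (intro relabel_step.inversion) simp
  ultimately have steps: "relabel_step\<^sup>*\<^sup>* (G, z) (H, w)" by simp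
  have "1 \<le> i \<and> i < j \<and> j \<le> (3::nat) \<longleftrightarrow> i = 1 \<and> j = 2 \<or> i = 2 \<and> j = 3 \<or> i = 1 \<and> j = 3"
    for i j by presburger
  then have K3: "arcs (complete_graph 3) = {(1, 2), (2, 3), (1, 3)}"
      "verts (complete_graph 3) = {1, 2, 3}"
    unfolding complete_graph_def pre_digraph.simps by (simp_all add: set_eq_iff) presburger
  let ?f = "\<lambda>v. if v = a then 1 else if v = b then 2 else 3 :: nat"
  let ?g = "\<lambda>x. if x = e then (1, 2) else if x = f then (2, 3) else (1, 3) :: nat \<times> nat"
  have "zgraph_isomorphic (G, z) (complete_graph 3, \<lambda>_. 0)"
    unfolding zgraph_isomorphic_def prod.case
  proof (rule exI[of _ H], rule exI[of _ w], intro conjI steps,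
      rule exI[of _ ?f], rule exI[of _ ?g], intro conjI ballI)
    show "bij_betw ?f (verts H) (verts (complete_graph 3))"
      unfolding H' K3 using G by (auto simp: bij_betw_def inj_on_def)
    show "bij_betw ?g (arcs H) (arcs (complete_graph 3))"
      unfolding H' K3 using G by (auto simp: bij_betw_def inj_on_def)
    fix x assume "x \<in> arcs H"
    then show "tail (complete_graph 3) (?g x) = ?f (tail H x)"
      "head (complete_graph 3) (?g x) = ?f (head H x)" "0 = w x"
      using H' G by (auto simp: complete_graph_def)
  qed
  then show ?thesis
    unfolding has_forbidden_minor_def has_minor_isomorphic_def by blast
qed

section \<open>Contraction of long cycles\<close>

text \<open>Distinct tails rule out loops and parallel arcs of equal direction. Opposite arcs
  between the same ends occur only if the cycle has two arcs, and there the nonzero sum keeps them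
  apart.\<close>

lemma spanning_cycle_simple_labelling:
  assumes cyc: "spanning_cycle G es"
    and len: "3 \<le> length es \<or> (\<exists>e f. es = [e, f] \<and> z e + z f \<noteq> 0)"
  shows "simple_labelling G z"
proof -
  have len2: "2 \<le> length es" using len by auto
  have d: "distinct (map (tail G) es)" and arcs: "arcs G = set es"
    using cyc by (auto simp: spanning_cycle_def)
  have hd: "head G (es ! t) = tail G (es ! (Suc t mod length es))" if "t < length es" for t
  proof -
    have "head G (es ! t) = map (head G) es ! t" using that by simp
    also have "\<dots> = map (tail G) es ! (Suc t mod length es)"
      using cyc that nth_rotate1[of t "map (tail G) es"] by (simp add: spanning_cycle_def)
    also have "\<dots> = tail G (es ! (Suc t mod length es))"
      using that by (intro nth_map mod_less_divisor) auto
    finally show ?thesis .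
  qed
  have succ: "Suc t mod length es = (if Suc t = length es then 0 else Suc t)"
    if "t < length es" for t
    using that by auto
  have inj: "s = t" if "tail G (es ! s) = tail G (es ! t)" "s < length es" "t < length es" for s t
    using that d by (auto simp: distinct_conv_nth)
  have ml: "Suc t mod length es < length es" for t
    using len2 by (intro mod_less_divisor) auto
  show ?thesis
    unfolding simple_labelling_def arcs
  proof (intro conjI ballI impI)
    fix e assume "e \<in> set es" "tail G e = head G e"
    then obtain t where t: "t < length es" "tail G (es ! t) = head G (es ! t)"
      by (auto simp: in_set_conv_nth)
    then have "t = Suc t mod length es"
      using hd inj ml by metis
    then show "z e \<noteq> 0"
      using t(1) len2 unfolding succ[OF t(1)] by (auto split: if_splits)
  next
    fix e f assume ef: "e \<in> set es" "f \<in> set es" "e \<noteq> f"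
    obtain s where s: "s < length es" "es ! s = e" using ef by (auto simp: in_set_conv_nth)
    obtain t where t: "t < length es" "es ! t = f" using ef by (auto simp: in_set_conv_nth)
    have ne: "s \<noteq> t" using s t ef(3) by auto
    show "\<not> same_labelled_edge G z e f"
    proof
      assume "same_labelled_edge G z e f"
      moreover have "tail G e \<noteq> tail G f"
        using inj s t ne by blast
      ultimately have op: "tail G e = head G f" "head G e = tail G f" "z e = - z f"
        by (auto simp: same_labelled_edge_def)
      \<comment> \<open>Opposite arcs are cyclic successors of each other, which forces the cycle to
        have length 2.\<close>
      have "tail G (es ! s) = tail G (es ! (Suc t mod length es))"
        unfolding hd[OF t(1), symmetric] unfolding s t by (fact op(1))
      from inj[OF this s(1) ml]
      have 1: "s = (if Suc t = length es then 0 else Suc t)"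
        unfolding succ[OF t(1)] .
      have "tail G (es ! t) = tail G (es ! (Suc s mod length es))"
        unfolding hd[OF s(1), symmetric] unfolding s t by (rule op(2)[symmetric])
      from inj[OF this t(1) ml]
      have 2: "t = (if Suc s = length es then 0 else Suc s)"
        unfolding succ[OF s(1)] .
      have "length es = 2"
      proof (cases "Suc t = length es")
        case True
        then have "s = 0" using 1 by argo
        then have "t = Suc 0" using 2 ne by argo
        then show ?thesis using True by simp
      next
        case False
        then have st: "s = Suc t" using 1 by argo
        then have "t \<noteq> Suc s" by simp
        then have "t = 0" "Suc s = length es" using 2 by argo+
        then show ?thesis using st by simp
      qed
      then obtain e' f' where "es = [e', f']" "z e' + z f' \<noteq> 0"
        using len by auto
      then show False
        using ef op(3) by auto
    qed
  qed
qed

text \<open>The condition on \<open>es\<close> speaks about the cycle after contraction: it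
  guarantees that the shorter cycle is simply labelled, so that every other arc survives.\<close>

lemma contract_spanning_cycle:
  assumes cyc: "spanning_cycle G (e # f # es)" and lab: "z e = 0"
    and len: "2 \<le> length es \<or> (\<exists>g. es = [g] \<and> z f + z g \<noteq> 0)"
  shows "\<exists>H. minor_step (G, z) (H, z) \<and> spanning_cycle H (f # es)"
proof -
  define H where "H = (identify_ends G e)\<lparr>arcs := set (f # es)\<rparr>"
  define a b vs where abv: "a = tail G e" "b = tail G f" "vs = map (tail G) es"
  have hds: "head G e = b" "head G f # map (head G) es = vs @ [a]"
    using cyc by (auto simp: spanning_cycle_def abv)
  have d: "a \<noteq> b" "a \<notin> set vs" "b \<notin> set vs" "distinct vs" "distinct es" "e \<noteq> f"
    "e \<notin> set es" "f \<notin> set es"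
    using cyc by (auto simp: spanning_cycle_def abv distinct_map)
  define c where "c v = (if v = b then a else v)" for v
  have c_eq: "c = (\<lambda>v. if v = head G e then tail G e else v)"
    by (simp add: fun_eq_iff c_def hds(1) abv(1))
  have I: "identify_ends G e =
      \<lparr>verts = c ` verts G, arcs = arcs G - {e}, tail = c \<circ> tail G, head = c \<circ> head G\<rparr>"
    by (simp add: identify_ends_def Let_def c_eq)
  have cvs: "map c vs = vs" "c ` set vs = set vs"
    using d by (auto simp: c_def intro: map_idI)
  have tails: "map (tail H) (f # es) = a # vs"
    using cvs by (auto simp: H_def I abv c_def)
  have "map (head H) (f # es) = map c (head G f # map (head G) es)"
    by (simp add: H_def I)
  also have "\<dots> = vs @ [a]"
    using cvs d unfolding hds by (simp add: c_def)
  finally have heads: "map (head H) (f # es) = vs @ [a]" .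
  have "verts H = insert a (set vs)"
    using cyc cvs by (auto simp: H_def I spanning_cycle_def abv c_def)
  then have sc: "spanning_cycle H (f # es)"
    unfolding spanning_cycle_def tails heads
    using d by (auto simp: H_def)
  have "simple_labelling H z"
    using sc by (rule spanning_cycle_simple_labelling) (use len in auto)
  moreover have "arcs G - {e} = set (f # es)"
    using cyc d by (auto simp: spanning_cycle_def)
  ultimately have "contraction_arcs G z e (set (f # es))"
    by (auto simp: contraction_arcs_def Let_def H_def I)
  then have "minor_step (G, z) (H, z)"
    unfolding H_def using cyc lab hds(1) d(1)
    by (intro minor_step.contract) (auto simp: spanning_cycle_def abv)
  then show ?thesis using sc by blast
qed

lemma spanning_cycle_has_forbidden_minor:
  assumes "spanning_cycle G es" "3 \<le> length es \<or> (\<exists>e f. es = [e, f] \<and> z e + z f \<noteq> 0)"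
  shows "has_forbidden_minor (G, z)"
  using assms
proof (induction "length es" arbitrary: G z es rule: less_induct)
  case less
  show ?case
  proof (cases "3 \<le> length es")
    case False
    then obtain e f where "es = [e, f]" "z e + z f \<noteq> 0"
      using less.prems(2) by blast
    then show ?thesis
      using less.prems(1) has_forbidden_minor_2_cycle[of G e f z] by simp
  next
    case True
    then obtain e f g es' where es: "es = e # f # g # es'"
      by (cases es; cases "tl es"; cases "tl (tl es)") auto
    obtain z' where z': "switch_vertex (tail G e) (- z e) (G, z) = (G, z')"
      by (auto simp: switch_vertex_def)
    have "tail G e \<noteq> head G e" "tail G e \<in> verts G"
      using less.prems(1) unfolding es by (auto simp: spanning_cycle_def)
    then have step: "minor_step (G, z) (G, z')" and z'e: "z' e = 0"
      using z' relabel_step.switching[of "tail G e" G z "- z e"]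
      by (auto simp: switch_vertex_def intro: minor_step.relabel)
    have "has_forbidden_minor (G, z')"
    \<comment> \<open>A balanced triangle is a final case. Otherwise the contraction leaves at least
      three arcs, or two arcs with nonzero sum, and the induction continues.\<close>
    proof (cases "es' = [] \<and> z' f + z' g = 0")
      case True
      then show ?thesis
        using less.prems(1) z'e es has_forbidden_minor_balanced_3_cycle[of G e f g z'] by simp
    next
      case False
      then have "2 \<le> length (g # es') \<or> (\<exists>h. g # es' = [h] \<and> z' f + z' h \<noteq> 0)"
        by (cases es') auto
      then obtain H where H: "minor_step (G, z') (H, z')" "spanning_cycle H (f # g # es')"
        using contract_spanning_cycle[of G e f "g # es'" z'] less.prems(1) z'e unfolding es by blast
      have "has_forbidden_minor (H, z')"
        by (rule less.hyps[OF _ H(2)]) (use es False in \<open>cases es'; auto\<close>)+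
      then show ?thesis
        using H(1) has_forbidden_minor_trans r_into_rtranclp by metis
    qed
    then show ?thesis
      using step has_forbidden_minor_trans r_into_rtranclp by metis
  qed
qed

lemma cycle_has_forbidden_minor:
  assumes Z: "Z_labelled_graph G z" and cyc: "undirected_cycle G vs es" and len: "2 \<le> length vs"
  shows "has_forbidden_minor (G, z)"
proof -
  have fin: "finite (verts G)" "finite (arcs G)" and simple: "simple_labelling G z"
    using Z by (auto simp: Z_labelled_graph_def fin_digraph_def fin_digraph_axioms_def)
  have c: "length es = length vs" "distinct vs" "distinct es" "set vs \<subseteq> verts G" "set es \<subseteq> arcs G"
    and ends: "\<And>t. t < length vs \<Longrightarrow>
      {tail G (es ! t), head G (es ! t)} = {vs ! t, vs ! (Suc t mod length vs)}"
    using cyc by (auto simp: undirected_cycle_def)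
  have ml: "Suc t mod length vs < length vs" for t
    using len by (intro mod_less_divisor) auto
  have on: "tail G e \<in> set vs \<and> head G e \<in> set vs" if e: "e \<in> set es" for e
  proof -
    obtain t where t: "t < length vs" "es ! t = e" using e c(1) by (auto simp: in_set_conv_nth)
    then have "{tail G e, head G e} \<subseteq> set vs"
      using ends[OF t(1)] ml[of t] by auto
    then show ?thesis by simp
  qed
  \<comment> \<open>Arcs off the cycle go first, so that the vertices off the cycle are isolated
    when they are deleted.\<close>
  define G1 where "G1 = G\<lparr>arcs := set es\<rparr>"
  define G2 where "G2 = G1\<lparr>verts := set vs\<rparr>"
  have "minor_step\<^sup>*\<^sup>* (G, z) (G\<lparr>arcs := arcs G - (arcs G - set es)\<rparr>, z)"
    using fin by (intro minor_delete_arcs) auto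
  also have "G\<lparr>arcs := arcs G - (arcs G - set es)\<rparr> = G1"
    using c(5) by (simp add: G1_def double_diff)
  finally have s1: "minor_step\<^sup>*\<^sup>* (G, z) (G1, z)" .
  have "minor_step\<^sup>*\<^sup>* (G1, z) (G1\<lparr>verts := verts G1 - (verts G - set vs)\<rparr>, z)"
    using fin on by (intro minor_delete_isolated_verts) (auto simp: G1_def)
  also have "G1\<lparr>verts := verts G1 - (verts G - set vs)\<rparr> = G2"
    using c(4) by (simp add: G1_def G2_def double_diff)
  finally have s2: "minor_step\<^sup>*\<^sup>* (G1, z) (G2, z)" .
  \<comment> \<open>The arcs that the cycle traverses against their direction; inverting them makes
    it a directed cycle.\<close>
  define B where "B = {es ! t | t. t < length vs \<and> tail G (es ! t) \<noteq> vs ! t}"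
  define z3 where "z3 = (\<lambda>e. if e \<in> B then - z e else z e)"
  define G3 where "G3 = G2\<lparr>tail := \<lambda>e. if e \<in> B then head G2 e else tail G2 e,
       head := \<lambda>e. if e \<in> B then tail G2 e else head G2 e\<rparr>"
  have B: "B \<subseteq> arcs G2"
    using c(1) by (auto simp: B_def G2_def G1_def)
  then have "finite B"
    by (rule finite_subset) (simp add: G2_def G1_def)
  then have s3: "minor_step\<^sup>*\<^sup>* (G2, z) (G3, z3)"
    unfolding G3_def z3_def using B by (intro minor_invert_arcs)
  have inB: "es ! t \<in> B \<longleftrightarrow> tail G (es ! t) \<noteq> vs ! t" if "t < length vs" for t
    using that c(1,3) by (auto simp: B_def nth_eq_iff_index_eq)
  have dir: "tail G3 (es ! t) = vs ! t \<and> head G3 (es ! t) = vs ! (Suc t mod length vs)"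
    if "t < length vs" for t
    using inB[OF that] ends[OF that] by (auto simp: G3_def G2_def G1_def doubleton_eq_iff)
  have tails: "map (tail G3) es = vs"
    using c(1) dir by (intro nth_equalityI) auto
  have heads: "map (head G3) es = rotate1 vs"
    using c(1) dir by (intro nth_equalityI) (auto simp: nth_rotate1)
  have sc: "spanning_cycle G3 es"
    unfolding spanning_cycle_def tails heads using c(2) by (simp add: G3_def G2_def G1_def)
  have "3 \<le> length es \<or> (\<exists>e f. es = [e, f] \<and> z3 e + z3 f \<noteq> 0)"
  proof (cases "3 \<le> length es")
    case False
    then have "length es = 2" using len c(1) by simp
    then obtain e f where es: "es = [e, f]"
      by (auto simp: numeral_2_eq_2 length_Suc_conv)
    \<comment> \<open>On two vertices the simple labelling of the given graph is what makes the sum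
      nonzero: two arcs with the same ends that become opposite with sum 0 would have coincided as
      labelled edges from the start.\<close>
    have "\<not> same_labelled_edge G z e f"
      using simple c(3,5) unfolding es simple_labelling_def by auto
    moreover have "tail G3 e = head G3 f" "head G3 e = tail G3 f"
      using sc by (simp_all add: es spanning_cycle_def)
    ultimately have "z3 e + z3 f \<noteq> 0"
      by (auto simp: G3_def G2_def G1_def z3_def same_labelled_edge_def split: if_splits)
    then show ?thesis using es by blast
  qed simp
  then have "has_forbidden_minor (G3, z3)"
    by (rule spanning_cycle_has_forbidden_minor[OF sc])
  then show ?thesis
    using s1 s2 s3 has_forbidden_minor_trans by blast
qed

section \<open>Closing the chain of implications\<close>

lemma line_realizable_imp_no_forbidden_minor:
  assumes "wf_digraph G" "line_realizable G z"
  shows "\<not> has_forbidden_minor (G, z)"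
proof -
  have "wf_digraph (complete_graph 3)" "wf_digraph K2_bullet"
    by (auto simp: wf_digraph_def complete_graph_def K2_bullet_def)
  then show ?thesis
    using line_realizable_minor[OF _ assms] not_line_realizable_K3 not_line_realizable_K2_bullet
    unfolding has_forbidden_minor_def by metis
qed

theorem theorem7p3:
  fixes G :: "('v, 'e) pre_digraph" and z :: "'e \<Rightarrow> int"
  assumes "Z_labelled_graph G z"
  shows "(rd G z \<le> 1 \<longleftrightarrow>
            \<not> has_minor_isomorphic (G, z) (complete_graph 3, \<lambda>_. 0) \<and>
            (\<forall>w. simple_labelling K2_bullet w \<longrightarrow> \<not> has_minor_isomorphic (G, z) (K2_bullet, w))) \<and>
         (rd G z \<le> 1 \<longleftrightarrow> sum_of_F G z) \<and>
         (rd G z \<le> 1 \<longleftrightarrow>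
            \<not> (\<exists>vs es. undirected_cycle G vs es \<and> \<not> (\<exists>e. es = [e] \<and> tail G e = head G e)))"
proof -
  have wf: "wf_digraph G"
    using assms by (simp add: Z_labelled_graph_def fin_digraph_def)
  let ?cyclic = "\<exists>vs es. undirected_cycle G vs es \<and> 2 \<le> length vs"
  have "line_realizable G z \<Longrightarrow> \<not> has_forbidden_minor (G, z)"
    by (rule line_realizable_imp_no_forbidden_minor[OF wf])
  moreover have "\<not> has_forbidden_minor (G, z) \<Longrightarrow> \<not> ?cyclic"
    using cycle_has_forbidden_minor[OF assms] by blast
  moreover have "\<not> ?cyclic \<Longrightarrow> sum_of_F G z"
    by (rule acyclic_imp_sum_of_F[OF assms])
  moreover have "sum_of_F G z \<Longrightarrow> line_realizable G z"
    by (rule sum_of_F_imp_line_realizable)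
  ultimately have "(line_realizable G z \<longleftrightarrow> \<not> has_forbidden_minor (G, z)) \<and>
      (line_realizable G z \<longleftrightarrow> sum_of_F G z) \<and> (line_realizable G z \<longleftrightarrow> \<not> ?cyclic)"
    by blast
  then show ?thesis
    unfolding rd_le_1_iff_line_realizable[OF wf] nontrivial_cycle_iff_length
      has_forbidden_minor_def by blast
qed

end
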